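(* Consider a Markov decision process $(r,\Gamma,\beta,P)$ with state space $\mathsf X$ and action space $\mathsf A$ satisfying the standing assumptions described in the context, and let $\sigma\in\Sigma$. If $P_\sigma$ is weakly irreducible and $\sigma$ is continuous (as a map $\mathsf X\to\mathsf A$), then the following three statements are equivalent: (E1) there exists $x\in\mathsf X$ such that $v_s(x)\le v_\sigma(x)$ for all $s\in\Sigma$; (E2) there exists a Borel probability measure $\rho$ on $\mathsf X$ such that $\int v_s\,\mathrm d\rho\le\int v_\sigma\,\mathrm d\rho$ for all $s\in\Sigma$; (E3) $\sigma$ is an optimal policy, i.e. $v_\sigma(x)=v^*(x)$ for all $x\in\mathsf X$.
   Context: $\mathsf X$ and $\mathsf A$ are metric spaces; $\mathscr B$ is the Borel $\sigma$-algebra of $\mathsf X$; $b\mathsf X$ is the space of bounded Borel measurable functions $\mathsf X\to\mathbb R$ (supremum norm, pointwise order), $cb\mathsf X$ the continuous ones. A Markov decision process is a tuple $(r,\Gamma,\beta,P)$ where: $\beta\in(0,1)$; $\Gamma$ is a nonempty, compact-valued, continuous correspondence from $\mathsf X$ to $\mathsf A$; with $\mathsf G=\{(x,a): a\in\Gamma(x)\}$, $r:\mathsf G\to\mathbb R$ is bounded and continuous; for each $(x,a)\in\mathsf G$, $P(x,a,\cdot)$ is a Borel probability measure on $\mathsf X$, and $(x,a)\mapsto\int v(x')P(x,a,\mathrm dx')$ is continuous on $\mathsf G$ for every $v\in cb\mathsf X$. $\Sigma$ is the set of Borel measurable $\sigma:\mathsf X\to\mathsf A$ with $\sigma(x)\in\Gamma(x)$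 for all $x$. For $\sigma\in\Sigma$, $r_\sigma(x)=r(x,\sigma(x))$, $P_\sigma(x,\mathrm dx')=P(x,\sigma(x),\mathrm dx')$ with Markov operator $(P_\sigma f)(x)=\int f(x')P_\sigma(x,\mathrm dx')$, $P_\sigma^n$ the $n$-step kernel, and $v_\sigma=\sum_{t\ge0}(\beta P_\sigma)^t r_\sigma$. The value function is $v^*(x)=\sup_{s\in\Sigma}v_s(x)$; $\sigma$ is optimal if $v_\sigma=v^*$ on $\mathsf X$. A transition kernel $Q$ on $\mathsf X$ is weakly irreducible if there is a measure $\pi$ on $(\mathsf X,\mathscr B)$ with $\pi(G)>0$ for every nonempty open $G\subset\mathsf X$ such that for every $x\in\mathsf X$ and every $B\in\mathscr B$ with $\pi(B)>0$ there is $n\in\mathbb N=\{1,2,\dots\}$ with $Q^n(x,B)>0$. *)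

theory Defs
  imports "HOL-Probability.Probability"
begin

definition upper_hemicontinuous :: "('x::topological_space \<Rightarrow> 'a::topological_space set) \<Rightarrow> bool" where
  "upper_hemicontinuous \<Gamma> \<longleftrightarrow>
     (\<forall>x V. open V \<and> \<Gamma> x \<subseteq> V \<longrightarrow> (\<exists>U. open U \<and> x \<in> U \<and> (\<forall>y\<in>U. \<Gamma> y \<subseteq> V)))"

definition lower_hemicontinuous :: "('x::topological_space \<Rightarrow> 'a::topological_space set) \<Rightarrow> bool" where
  "lower_hemicontinuous \<Gamma> \<longleftrightarrow>
     (\<forall>x V. open V \<and> \<Gamma> x \<inter> V \<noteq> {} \<longrightarrow> (\<exists>U. open U \<and> x \<in> U \<and> (\<forall>y\<in>U. \<Gamma> y \<inter> V \<noteq> {})))"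

definition continuous_correspondence :: "('x::topological_space \<Rightarrow> 'a::topological_space set) \<Rightarrow> bool" where
  "continuous_correspondence \<Gamma> \<longleftrightarrow> upper_hemicontinuous \<Gamma> \<and> lower_hemicontinuous \<Gamma>"

definition graph_corr :: "('x \<Rightarrow> 'a set) \<Rightarrow> ('x \<times> 'a) set" where
  "graph_corr \<Gamma> = {(x, a). a \<in> \<Gamma> x}"

definition MDP :: "('x::metric_space \<Rightarrow> 'a::metric_space \<Rightarrow> real) \<Rightarrow> ('x \<Rightarrow> 'a set) \<Rightarrow> real
                    \<Rightarrow> ('x \<Rightarrow> 'a \<Rightarrow> 'x measure) \<Rightarrow> bool" where
  "MDP r \<Gamma> \<beta> P \<longleftrightarrow>
     0 < \<beta> \<and> \<beta> < 1 \<and>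
     (\<forall>x. \<Gamma> x \<noteq> {} \<and> compact (\<Gamma> x)) \<and>
     continuous_correspondence \<Gamma> \<and>
     bounded ((\<lambda>(x, a). r x a) ` graph_corr \<Gamma>) \<and>
     continuous_on (graph_corr \<Gamma>) (\<lambda>(x, a). r x a) \<and>
     (\<forall>(x, a) \<in> graph_corr \<Gamma>. prob_space (P x a) \<and> sets (P x a) = sets borel) \<and>
     (\<forall>v::'x \<Rightarrow> real. continuous_on UNIV v \<and> bounded (range v) \<longrightarrow>
        continuous_on (graph_corr \<Gamma>) (\<lambda>(x, a). \<integral>x'. v x' \<partial>(P x a)))"

definition policies :: "('x::metric_space \<Rightarrow> 'a::metric_space set) \<Rightarrow> ('x \<Rightarrow> 'a) set" where
  "policies \<Gamma> = {\<sigma>. \<sigma> \<in> borel_measurable borel \<and> (\<forall>x. \<sigma> x \<in> \<Gamma> x)}"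

definition markov_op :: "('x::metric_space \<Rightarrow> 'x measure) \<Rightarrow> ('x \<Rightarrow> real) \<Rightarrow> 'x \<Rightarrow> real" where
  "markov_op K f x = (\<integral>x'. f x' \<partial>(K x))"

definition kernel_pow :: "('x::metric_space \<Rightarrow> 'x measure) \<Rightarrow> nat \<Rightarrow> 'x \<Rightarrow> 'x set \<Rightarrow> real" where
  "kernel_pow K n x B = (markov_op K ^^ n) (indicator B) x"

definition weakly_irreducible :: "('x::metric_space \<Rightarrow> 'x measure) \<Rightarrow> bool" where
  "weakly_irreducible K \<longleftrightarrow>
     (\<exists>\<pi>::'x measure. sets \<pi> = sets borel \<and>
        (\<forall>G. open G \<and> G \<noteq> {} \<longrightarrow> emeasure \<pi> G > 0) \<and>
        (\<forall>x B. B \<in> sets borel \<and> emeasure \<pi> B > 0 \<longrightarrow> (\<exists>n\<ge>1. kernel_pow K n x B > 0)))"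

definition policy_kernel :: "('x \<Rightarrow> 'a \<Rightarrow> 'x measure) \<Rightarrow> ('x \<Rightarrow> 'a) \<Rightarrow> 'x \<Rightarrow> 'x measure" where
  "policy_kernel P \<sigma> x = P x (\<sigma> x)"

definition policy_reward :: "('x \<Rightarrow> 'a \<Rightarrow> real) \<Rightarrow> ('x \<Rightarrow> 'a) \<Rightarrow> 'x \<Rightarrow> real" where
  "policy_reward r \<sigma> x = r x (\<sigma> x)"

definition policy_value :: "('x::metric_space \<Rightarrow> 'a \<Rightarrow> real) \<Rightarrow> real \<Rightarrow> ('x \<Rightarrow> 'a \<Rightarrow> 'x measure)
                            \<Rightarrow> ('x \<Rightarrow> 'a) \<Rightarrow> 'x \<Rightarrow> real" where
  "policy_value r \<beta> P \<sigma> x =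
     (\<Sum>t. \<beta> ^ t * (markov_op (policy_kernel P \<sigma>) ^^ t) (policy_reward r \<sigma>) x)"

definition value_function :: "('x::metric_space \<Rightarrow> 'a::metric_space \<Rightarrow> real) \<Rightarrow> ('x \<Rightarrow> 'a set) \<Rightarrow> real
                              \<Rightarrow> ('x \<Rightarrow> 'a \<Rightarrow> 'x measure) \<Rightarrow> 'x \<Rightarrow> real" where
  "value_function r \<Gamma> \<beta> P x = (SUP s\<in>policies \<Gamma>. policy_value r \<beta> P s x)"

end

theory Submission
  imports Defs
begin

text \<open>
  Fix a state \<open>x\<close>. Disjoint nonempty open sets are charged by the powers of the kernel started at
  \<open>x\<close>, so only countably many exist and the state space is separable; hence so is the union of the
  feasible sets. Therefore Berge's maximum theorem, Banach's fixed point theorem and a measurable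
  selection give a continuous bounded solution \<open>V\<close> of the Bellman equation that is the value of a
  stationary policy and dominates all others. Applied to the correspondence \<open>x \<mapsto> {\<sigma> x}\<close>, the
  same result shows that the value of \<open>\<sigma>\<close> is continuous. The gap \<open>h\<close> between \<open>V\<close> and
  the value of \<open>\<sigma>\<close> is continuous, nonnegative and satisfies \<open>\<beta>\<^sup>n P\<^sub>\<sigma>\<^sup>n h \<le> h\<close>; if it
  vanishes at one point, weak irreducibility prevents it from being positive on a nonempty open set.
\<close>

subsection \<open>Markov operators on bounded Borel functions\<close>

definition bounded_borel :: "('x::metric_space \<Rightarrow> real) \<Rightarrow> bool" where
  "bounded_borel f \<longleftrightarrow> f \<in> borel_measurable borel \<and> bounded (range f)"

text \<open>Measurability into \<open>subprob_algebra borel\<close> gives measurability of integrals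
  against \<open>K x\<close> directly. That space also contains measures of mass below one, hence
  the separate probability condition.\<close>

definition markov_kernel :: "('x::metric_space \<Rightarrow> 'x measure) \<Rightarrow> bool" where
  "markov_kernel K \<longleftrightarrow> K \<in> borel \<rightarrow>\<^sub>M subprob_algebra borel \<and> (\<forall>x. prob_space (K x))"

lemma markov_kernelD:
  assumes "markov_kernel K"
  shows "K \<in> borel \<rightarrow>\<^sub>M subprob_algebra borel" "prob_space (K x)" "sets (K x) = sets borel"
    "space (K x) = UNIV"
proof -
  show *: "K \<in> borel \<rightarrow>\<^sub>M subprob_algebra borel" "prob_space (K x)"
    using assms by (auto simp: markov_kernel_def)
  show "sets (K x) = sets borel"
    using sets_kernel[OF *(1)] by simp
  then show "space (K x) = UNIV"
    using sets_eq_imp_space_eq by fastforce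
qed

lemma bounded_borelE:
  assumes "bounded_borel f"
  obtains C where "f \<in> borel_measurable borel" "0 \<le> C" "\<And>x. \<bar>f x\<bar> \<le> C"
proof -
  obtain C where "\<And>x. \<bar>f x\<bar> \<le> C"
    using assms by (auto simp: bounded_borel_def bounded_iff)
  moreover from this[of undefined] have "0 \<le> C" by linarith
  ultimately show thesis using that assms by (auto simp: bounded_borel_def)
qed

lemma bounded_borelI:
  "f \<in> borel_measurable borel \<Longrightarrow> (\<And>x. \<bar>f x\<bar> \<le> C) \<Longrightarrow> bounded_borel f"
  by (auto simp: bounded_borel_def bounded_iff)

lemma bounded_borel_continuous:
  "continuous_on UNIV f \<Longrightarrow> bounded (range f) \<Longrightarrow> bounded_borel f"
  by (auto simp: bounded_borel_def intro: borel_measurable_continuous_onI)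

lemma bounded_borel_add:
  assumes "bounded_borel f" "bounded_borel g"
  shows "bounded_borel (\<lambda>x. f x + g x)"
proof -
  obtain C where f: "f \<in> borel_measurable borel" "\<And>x. \<bar>f x\<bar> \<le> C"
    using bounded_borelE[OF assms(1)] by metis
  obtain D where g: "g \<in> borel_measurable borel" "\<And>x. \<bar>g x\<bar> \<le> D"
    using bounded_borelE[OF assms(2)] by metis
  show ?thesis
  proof (rule bounded_borelI[where C="C + D"])
    show "\<bar>f x + g x\<bar> \<le> C + D" for x
      using f(2)[of x] g(2)[of x] by linarith
  qed (use f g in measurable)
qed

lemma bounded_borel_cmult:
  assumes "bounded_borel f"
  shows "bounded_borel (\<lambda>x. c * f x)"
proof -
  obtain C where f: "f \<in> borel_measurable borel" "\<And>x. \<bar>f x\<bar> \<le> C"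
    using bounded_borelE[OF assms(1)] by metis
  show ?thesis
    by (rule bounded_borelI[where C="\<bar>c\<bar> * C"])
      (use f in \<open>auto simp: abs_mult intro!: mult_left_mono borel_measurable_times\<close>)
qed

lemma bounded_borel_indicator: "B \<in> sets borel \<Longrightarrow> bounded_borel (indicator B)"
  by (rule bounded_borelI[where C=1]) (auto simp: indicator_def)

text \<open>Integrals of bounded continuous functions suffice: the indicator of an open set is a
  pointwise limit of such functions, so dominated convergence makes the mass of every open set
  measurable in \<open>x\<close>, and the open sets form a generator of the Borel sets stable under
  intersection.\<close>

lemma markov_kernelI:
  fixes K :: "'x::metric_space \<Rightarrow> 'x measure"
  assumes prob: "\<And>x. prob_space (K x)" and sets: "\<And>x. sets (K x) = sets borel"
    and meas: "\<And>v :: 'x \<Rightarrow> real. continuous_on UNIV v \<Longrightarrow> bounded (range v) \<Longrightarrow>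
       (\<lambda>x. \<integral>y. v y \<partial>K x) \<in> borel_measurable borel"
  shows "markov_kernel K"
proof -
  have [measurable_cong]: "sets (K x) = sets borel" for x
    by (rule sets)
  have *: "(\<lambda>x. emeasure (K x) S) \<in> borel_measurable borel" if S: "open S" for S
  proof -
    \<comment> \<open>The case \<open>S = UNIV\<close> is separate because \<open>- S\<close> is
      then empty and \<open>infdist y {}\<close> is 0 by convention, so the general formula would
      give 0 instead of 1.\<close>
    define f where "f n y = (if S = UNIV then 1 else min 1 (real n * infdist y (- S)))" for n y
    have f_cont: "continuous_on UNIV (f n)" for n
      unfolding f_def by (cases "S = UNIV") (auto intro!: continuous_intros)
    have f_bound: "\<bar>f n y\<bar> \<le> 1" for n y
      by (auto simp: f_def infdist_nonneg)
    have f_lim: "(\<lambda>n. f n y) \<longlonglongrightarrow> indicator S y" for y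
    proof (cases "y \<in> S \<and> S \<noteq> UNIV")
      case True
      have "infdist y (- S) > 0"
        using True S by (intro infdist_pos_not_in_closed) auto
      then obtain N :: nat where N: "1 \<le> real N * infdist y (- S)"
        by (meson less_imp_le reals_Archimedean3)
      have "f n y = 1" if "n \<ge> N" for n
      proof -
        have "real N * infdist y (- S) \<le> real n * infdist y (- S)"
          using that by (intro mult_right_mono) (auto simp: infdist_nonneg)
        then show ?thesis using N True by (simp add: f_def)
      qed
      then have "eventually (\<lambda>n. f n y = 1) sequentially"
        unfolding eventually_sequentially by blast
      then show ?thesis
        using True by (simp add: tendsto_eventually)
    next
      case False
      then have "f n y = indicator S y" for n
        by (auto simp: f_def)
      then show ?thesis by simp
    qed
    have "(\<lambda>n. \<integral>y. f n y \<partial>K x) \<longlonglongrightarrow> (\<integral>y. indicator S y \<partial>K x)" for x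
    proof (rule integral_dominated_convergence[where w="\<lambda>_. 1"])
      interpret prob_space "K x" by (rule prob)
      show "integrable (K x) (\<lambda>_. 1 :: real)" by simp
      show "f n \<in> borel_measurable (K x)" for n
        using borel_measurable_continuous_onI[OF f_cont] by simp
      show "(indicat_real S) \<in> borel_measurable (K x)"
        using S by (intro borel_measurable_indicator) (simp add: sets)
    qed (use f_lim f_bound in auto)
    moreover have "(\<lambda>x. \<integral>y. f n y \<partial>K x) \<in> borel_measurable borel" for n
      using f_bound by (intro meas f_cont) (auto simp: bounded_iff)
    ultimately have "(\<lambda>x. \<integral>y. indicat_real S y \<partial>K x) \<in> borel_measurable borel"
      by (rule borel_measurable_LIMSEQ_real)
    moreover have "emeasure (K x) S = ennreal (\<integral>y. indicat_real S y \<partial>K x)" for x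
    proof -
      interpret prob_space "K x" by (rule prob)
      show ?thesis
        using S sets[of x] sets_eq_imp_space_eq[OF sets[of x]] by (simp add: emeasure_eq_measure)
    qed
    ultimately show ?thesis by simp
  qed
  have "K \<in> borel \<rightarrow>\<^sub>M subprob_algebra borel"
  proof (rule measurable_subprob_algebra_generated[where \<Omega>=UNIV and G="{S. open S}"])
    show "subprob_space (K x)" for x
      using prob by (rule prob_space_imp_subprob_space)
  qed (auto simp: sets_borel Int_stable_def * sets)
  then show ?thesis
    using prob by (simp add: markov_kernel_def)
qed

lemma integrable_bounded_borel:
  assumes "prob_space M" "sets M = sets borel" "bounded_borel f"
  shows "integrable M f"
proof -
  interpret prob_space M by fact
  obtain C where f: "f \<in> borel_measurable borel" "\<And>x. \<bar>f x\<bar> \<le> C"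
    using bounded_borelE[OF assms(3)] by metis
  show ?thesis
    by (rule integrable_const_bound[where B=C])
      (use f measurable_cong_sets[OF assms(2), of borel borel] in auto)
qed

lemma markov_kernel_integrable:
  "markov_kernel K \<Longrightarrow> bounded_borel f \<Longrightarrow> integrable (K x) f"
  by (intro integrable_bounded_borel markov_kernelD)

lemma markov_op_abs_le:
  assumes K: "markov_kernel K" and f: "bounded_borel f" and "\<And>x. \<bar>f x\<bar> \<le> C"
  shows "\<bar>markov_op K f x\<bar> \<le> C"
proof -
  interpret prob_space "K x" using K by (rule markov_kernelD)
  have "\<bar>markov_op K f x\<bar> \<le> (\<integral>y. \<bar>f y\<bar> \<partial>K x)"
    unfolding markov_op_def using integral_norm_bound[of "K x" f] by simp
  also have "\<dots> \<le> (\<integral>y. C \<partial>K x)"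
    using assms by (intro integral_mono integrable_abs markov_kernel_integrable[OF K f]) auto
  finally show ?thesis by (simp add: prob_space)
qed

lemma bounded_borel_markov_op:
  assumes K: "markov_kernel K" and f: "bounded_borel f"
  shows "bounded_borel (markov_op K f)"
proof -
  obtain C where C: "f \<in> borel_measurable borel" "\<And>x. \<bar>f x\<bar> \<le> C"
    using bounded_borelE[OF f] by metis
  note [measurable] = markov_kernelD(1)[OF K] C(1)
  have "markov_op K f \<in> borel_measurable borel"
    unfolding markov_op_def by measurable
  then show ?thesis
    by (rule bounded_borelI[OF _ markov_op_abs_le[OF K f C(2)]])
qed

lemma bounded_borel_markov_op_power:
  "markov_kernel K \<Longrightarrow> bounded_borel f \<Longrightarrow> bounded_borel ((markov_op K ^^ n) f)"
  by (induction n) (auto intro: bounded_borel_markov_op)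

lemma markov_op_add:
  assumes "markov_kernel K" "bounded_borel f" "bounded_borel g"
  shows "markov_op K (\<lambda>x. f x + g x) = (\<lambda>x. markov_op K f x + markov_op K g x)"
  unfolding markov_op_def using assms by (auto intro!: Bochner_Integration.integral_add markov_kernel_integrable)

lemma markov_op_cmult: "markov_op K (\<lambda>x. c * f x) = (\<lambda>x. c * markov_op K f x)"
  by (rule ext) (simp add: markov_op_def)

lemma markov_op_mono:
  assumes "markov_kernel K" "bounded_borel f" "bounded_borel g" "\<And>x. f x \<le> g x"
  shows "markov_op K f x \<le> markov_op K g x"
  unfolding markov_op_def using assms by (auto intro!: integral_mono markov_kernel_integrable)

lemma markov_op_power_abs_le:
  assumes "markov_kernel K" "bounded_borel f" "\<And>x. \<bar>f x\<bar> \<le> C"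
  shows "\<bar>(markov_op K ^^ n) f x\<bar> \<le> C"
  using assms
  by (induction n arbitrary: x) (auto intro: markov_op_abs_le bounded_borel_markov_op_power)

lemma markov_op_power_add:
  assumes "markov_kernel K" "bounded_borel f" "bounded_borel g"
  shows "(markov_op K ^^ n) (\<lambda>x. f x + g x) = (\<lambda>x. (markov_op K ^^ n) f x + (markov_op K ^^ n) g x)"
  by (induction n) (simp_all add: assms markov_op_add bounded_borel_markov_op_power)

lemma markov_op_power_cmult:
  "(markov_op K ^^ n) (\<lambda>x. c * f x) = (\<lambda>x. c * (markov_op K ^^ n) f x)"
  by (induction n) (simp_all add: markov_op_cmult)

lemma markov_op_power_mono:
  assumes "markov_kernel K" "bounded_borel f" "bounded_borel g" "\<And>x. f x \<le> g x"
  shows "(markov_op K ^^ n) f x \<le> (markov_op K ^^ n) g x"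
  using assms by (induction n arbitrary: x) (auto intro: markov_op_mono bounded_borel_markov_op_power)

lemma bounded_borel_sum:
  "(\<And>i. i \<in> I \<Longrightarrow> bounded_borel (f i)) \<Longrightarrow> bounded_borel (\<lambda>x. \<Sum>i\<in>I. f i x)"
proof (induction I rule: infinite_finite_induct)
  case (insert i I)
  then show ?case
    using bounded_borel_add[of "f i"] by simp
qed (auto intro: bounded_borelI)

lemma markov_op_power_sum:
  assumes "markov_kernel K" "finite I" "\<And>i. i \<in> I \<Longrightarrow> bounded_borel (f i)"
  shows "(markov_op K ^^ n) (\<lambda>x. \<Sum>i\<in>I. f i x) = (\<lambda>x. \<Sum>i\<in>I. (markov_op K ^^ n) (f i) x)"
  using assms(2,3)
proof (induction I)
  case empty
  show ?case
    \<comment> \<open>The empty sum is 0 times a function, so homogeneity makes its image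
      vanish.\<close>
    using markov_op_power_cmult[of n K 0 "\<lambda>_. 0"] by simp
next
  case (insert i I)
  then show ?case
    by (simp add: markov_op_power_add[OF assms(1)] bounded_borel_sum)
qed

lemma markov_op_power_Suc: "(markov_op K ^^ Suc n) f = (markov_op K ^^ n) (markov_op K f)"
  by (simp only: funpow_Suc_right comp_apply)

section \<open>Discounted sums and their fixed point equation\<close>

lemma summable_discounted:
  assumes K: "markov_kernel K" and f: "bounded_borel f" and b: "0 \<le> \<beta>" "\<beta> < 1"
  shows "summable (\<lambda>t. \<beta> ^ t * (markov_op K ^^ t) f x)"
proof -
  obtain C where "\<And>x. \<bar>f x\<bar> \<le> C"
    using bounded_borelE[OF f] by metis
  note le = markov_op_power_abs_le[OF K f this]
  have "summable (\<lambda>t. \<beta> ^ t * C)"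
    using b by (intro summable_mult2 summable_geometric) simp
  then show ?thesis
  proof (rule summable_comparison_test')
    show "norm (\<beta> ^ t * (markov_op K ^^ t) f x) \<le> \<beta> ^ t * C" for t
      using b le[of t x] by (auto simp: abs_mult intro!: mult_left_mono)
  qed
qed

text \<open>Iterating the hypothesis \<open>n\<close> times bounds the first \<open>n\<close> terms
  plus the remainder \<open>\<beta> ^ n * (markov_op K ^^ n) V x\<close> by \<open>V x\<close>; the
  remainder tends to 0 because \<open>V\<close> is bounded.\<close>

lemma discounted_sum_le:
  assumes K: "markov_kernel K" and f: "bounded_borel f" and V: "bounded_borel V"
    and b: "0 \<le> \<beta>" "\<beta> < 1"
    and le: "\<And>x. f x + \<beta> * markov_op K V x \<le> V x"
  shows "(\<Sum>t. \<beta> ^ t * (markov_op K ^^ t) f x) \<le> V x"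
proof -
  obtain C where C: "\<And>x. \<bar>V x\<bar> \<le> C"
    using bounded_borelE[OF V] by metis
  have *: "(\<Sum>t<n. \<beta> ^ t * (markov_op K ^^ t) f x) + \<beta> ^ n * (markov_op K ^^ n) V x \<le> V x" for n
  proof (induction n)
    case (Suc n)
    have "(markov_op K ^^ n) f x + \<beta> * (markov_op K ^^ Suc n) V x
        = (markov_op K ^^ n) (\<lambda>x. f x + \<beta> * markov_op K V x) x"
      by (subst markov_op_power_add[OF K f bounded_borel_cmult[OF bounded_borel_markov_op[OF K V]]])
        (simp add: markov_op_power_cmult markov_op_power_Suc del: funpow.simps)
    also have "\<dots> \<le> (markov_op K ^^ n) V x"
      by (intro markov_op_power_mono K V bounded_borel_add bounded_borel_cmult bounded_borel_markov_op f le)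
    finally have "\<beta> ^ n * ((markov_op K ^^ n) f x + \<beta> * (markov_op K ^^ Suc n) V x)
        \<le> \<beta> ^ n * (markov_op K ^^ n) V x"
      using b by (intro mult_left_mono) auto
    then show ?case
      using Suc by (simp add: algebra_simps)
  qed simp
  have "(\<lambda>n. \<beta> ^ n * C) \<longlonglongrightarrow> 0"
    using b by (intro tendsto_mult_left_zero LIMSEQ_realpow_zero)
  then have "(\<lambda>n. \<beta> ^ n * (markov_op K ^^ n) V x) \<longlonglongrightarrow> 0"
  proof (rule Lim_null_comparison[rotated])
    show "\<forall>\<^sub>F n in sequentially. norm (\<beta> ^ n * (markov_op K ^^ n) V x) \<le> \<beta> ^ n * C"
      using b markov_op_power_abs_le[OF K V C]
      by (intro always_eventually allI) (auto simp: abs_mult intro!: mult_left_mono)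
  qed
  with summable_LIMSEQ[OF summable_discounted[OF K f b]]
  have "(\<lambda>n. (\<Sum>t<n. \<beta> ^ t * (markov_op K ^^ t) f x) + \<beta> ^ n * (markov_op K ^^ n) V x)
      \<longlonglongrightarrow> (\<Sum>t. \<beta> ^ t * (markov_op K ^^ t) f x) + 0"
    by (rule tendsto_add)
  then show ?thesis
    using * by (intro LIMSEQ_le_const2[where a="V x"]) auto
qed

lemma discounted_sum_eqI:
  assumes K: "markov_kernel K" and f: "bounded_borel f" and V: "bounded_borel V"
    and b: "0 \<le> \<beta>" "\<beta> < 1"
    and eq: "\<And>x. f x + \<beta> * markov_op K V x = V x"
  shows "(\<Sum>t. \<beta> ^ t * (markov_op K ^^ t) f x) = V x"
proof (rule antisym)
  show "(\<Sum>t. \<beta> ^ t * (markov_op K ^^ t) f x) \<le> V x"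
    using discounted_sum_le[OF K f V b] eq by simp
  \<comment> \<open>The reverse inequality is the same bound applied to the negatives of
    \<open>f\<close> and \<open>V\<close>, written as multiples by \<open>- 1\<close> so that the
    homogeneity rules apply.\<close>
  have "(\<Sum>t. \<beta> ^ t * (markov_op K ^^ t) (\<lambda>x. - 1 * f x) x) \<le> - 1 * V x"
    using bounded_borel_cmult[OF f, of "- 1"] bounded_borel_cmult[OF V, of "- 1"]
  proof (rule discounted_sum_le[OF K _ _ b])
    show "- 1 * f x + \<beta> * markov_op K (\<lambda>x. - 1 * V x) x \<le> - 1 * V x" for x
      using eq[of x] unfolding markov_op_cmult by simp
  qed
  then show "V x \<le> (\<Sum>t. \<beta> ^ t * (markov_op K ^^ t) f x)"
    using suminf_minus[OF summable_discounted[OF K f b, of x]]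
    unfolding markov_op_power_cmult by simp
qed

lemma measurable_discounted_sum:
  assumes K: "markov_kernel K" and f: "bounded_borel f"
  shows "(\<lambda>x. \<Sum>t. \<beta> ^ t * (markov_op K ^^ t) f x) \<in> borel_measurable borel"
proof -
  have [measurable]: "(markov_op K ^^ t) f \<in> borel_measurable borel" for t
    using bounded_borel_markov_op_power[OF K f] by (simp add: bounded_borel_def)
  show ?thesis by measurable
qed

text \<open>A minimum principle. Iteration turns \<open>h x = 0\<close> into vanishing of all
  \<open>(markov_op K ^^ n) h x\<close>, whereas a positive value of \<open>h\<close> somewhere is,
  by continuity, a lower bound up to a factor 2 on an open set that is reached from \<open>x\<close>
  with positive probability in some number of steps.\<close>

lemma superharmonic_zero:
  assumes K: "markov_kernel K" and irr: "weakly_irreducible K"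
    and cont: "continuous_on UNIV h" and bdd: "bounded (range h)" and nonneg: "\<And>y. 0 \<le> h y"
    and b: "0 < \<beta>" and le: "\<And>y. \<beta> * markov_op K h y \<le> h y" and x: "h x = 0"
  shows "h y = 0"
proof (rule ccontr)
  assume "h y \<noteq> 0"
  with nonneg[of y] have y: "0 < h y" by simp
  have h: "bounded_borel h"
    using cont bdd by (rule bounded_borel_continuous)
  define G where "G = {z. h y / 2 < h z}"
  have G: "open G" "y \<in> G"
    unfolding G_def using y cont by (auto intro!: open_Collect_less continuous_intros)
  then obtain n where n: "kernel_pow K n x G > 0"
    using irr unfolding weakly_irreducible_def by (metis borel_open empty_iff)
  have iter: "\<beta> ^ n * (markov_op K ^^ n) h z \<le> h z" for n z
  proof (induction n)
    case (Suc n)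
    have "\<beta> ^ n * (markov_op K ^^ n) (\<lambda>y. \<beta> * markov_op K h y) z \<le> \<beta> ^ n * (markov_op K ^^ n) h z"
      using b h K le
      by (intro mult_left_mono markov_op_power_mono bounded_borel_cmult bounded_borel_markov_op) auto
    also have "\<dots> \<le> h z" by fact
    finally show ?case
      by (simp add: markov_op_power_cmult markov_op_power_Suc algebra_simps del: funpow.simps)
  qed simp
  have "(markov_op K ^^ n) h x \<le> 0"
    using iter[of n x] x zero_less_power[OF b, of n] by (simp add: mult_le_0_iff)
  \<comment> \<open>The function \<open>h\<close> dominates half of \<open>h y\<close> times the
    indicator of \<open>G\<close>, which brings in the \<open>n\<close>-step probability of
    \<open>G\<close>.\<close>
  moreover have "(markov_op K ^^ n) (\<lambda>z. h y / 2 * indicator G z) x \<le> (markov_op K ^^ n) h x"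
  proof (rule markov_op_power_mono[OF K _ h])
    show "bounded_borel (\<lambda>z. h y / 2 * indicator G z)"
      using G by (intro bounded_borel_cmult bounded_borel_indicator) auto
    show "h y / 2 * indicator G z \<le> h z" for z
      using nonneg[of z] by (auto simp: G_def indicator_def)
  qed
  ultimately have "h y / 2 * kernel_pow K n x G \<le> 0"
    unfolding kernel_pow_def markov_op_power_cmult by linarith
  with n y show False
    by (simp add: mult_le_0_iff)
qed

subsection \<open>Separability and measurable selection\<close>

text \<open>The union of the countable nets over all scales works. The points of the nets may lie
  outside \<open>A\<close>, so the conclusion is inclusion in a closure.\<close>

lemma countable_dense_from_nets:
  fixes A :: "'a::metric_space set"
  assumes "\<And>n. \<exists>E. countable E \<and> (\<forall>a\<in>A. \<exists>b\<in>E. dist a b < inverse (Suc n))"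
  shows "\<exists>E. countable E \<and> A \<subseteq> closure E"
proof -
  obtain E :: "nat \<Rightarrow> 'a set" where E: "\<And>n. countable (E n)"
      "\<And>n a. a \<in> A \<Longrightarrow> \<exists>b\<in>E n. dist a b < inverse (Suc n)"
    using assms by metis
  have "a \<in> closure (\<Union>n. E n)" if a: "a \<in> A" for a
    unfolding closure_approachable
  proof (intro allI impI)
    fix e :: real assume "0 < e"
    then obtain n where n: "inverse (Suc n) < e"
      using reals_Archimedean by blast
    obtain b where "b \<in> E n" "dist a b < inverse (Suc n)"
      using E(2)[OF a] by blast
    then show "\<exists>y\<in>\<Union>n. E n. dist y a < e"
      using n by (auto simp: dist_commute intro!: bexI[of _ b])
  qed
  then show ?thesis
    using E(1) by (intro exI[of _ "\<Union>n. E n"]) auto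
qed

text \<open>Zorn's lemma gives a maximal separated set; a point at distance at least
  \<open>e\<close> from all its members could be added to it, so it is also a net.\<close>

lemma max_separated_set:
  fixes e :: real
  assumes "e > 0"
  obtains S :: "'x::metric_space set" where
    "\<And>x y. x \<in> S \<Longrightarrow> y \<in> S \<Longrightarrow> x \<noteq> y \<Longrightarrow> e \<le> dist x y"
    "\<And>x. \<exists>y\<in>S. dist x y < e"
proof -
  define A where "A = {S :: 'x set. \<forall>x\<in>S. \<forall>y\<in>S. x \<noteq> y \<longrightarrow> e \<le> dist x y}"
  have "\<exists>M\<in>A. \<forall>X\<in>A. M \<subseteq> X \<longrightarrow> X = M"
  proof (rule subset_Zorn')
    fix C assume C: "subset.chain A C"
    show "\<Union>C \<in> A"
      unfolding A_def
    proof (safe)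
      fix x y X Y assume *: "x \<in> X" "y \<in> Y" "x \<noteq> y" "X \<in> C" "Y \<in> C"
      then have "X \<subseteq> Y \<or> Y \<subseteq> X" "X \<in> A" "Y \<in> A"
        using C by (auto simp: subset.chain_def)
      then show "e \<le> dist x y"
        using * unfolding A_def by blast
    qed
  qed
  then obtain M where M: "M \<in> A" "\<And>X. X \<in> A \<Longrightarrow> M \<subseteq> X \<Longrightarrow> X = M" by blast
  show thesis
  proof (rule that[of M])
    show "e \<le> dist x y" if "x \<in> M" "y \<in> M" "x \<noteq> y" for x y
      using M(1) that by (auto simp: A_def)
    show "\<exists>y\<in>M. dist x y < e" for x
    proof (rule ccontr)
      assume *: "\<not> (\<exists>y\<in>M. dist x y < e)"
      then have "insert x M \<in> A"
        using M(1) by (auto simp: A_def not_less dist_commute)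
      then have "x \<in> M" using M(2) by blast
      with * \<open>e > 0\<close> show False by auto
    qed
  qed
qed

text \<open>Balls of half the separation distance around the points of a maximal separated set are
  disjoint, so the chain condition makes that set countable, and at every scale it is a net.\<close>

lemma ccc_metric_countable_dense:
  assumes ccc: "\<And>F :: 'x::metric_space set set.
      (\<And>G. G \<in> F \<Longrightarrow> open G \<and> G \<noteq> {}) \<Longrightarrow> disjoint F \<Longrightarrow> countable F"
  shows "\<exists>D :: 'x set. countable D \<and> closure D = UNIV"
proof -
  have "\<exists>S :: 'x set. countable S \<and> (\<forall>x. \<exists>y\<in>S. dist x y < inverse (Suc n))" for n
  proof -
    obtain S :: "'x set" where
      sep: "\<And>x y. x \<in> S \<Longrightarrow> y \<in> S \<Longrightarrow> x \<noteq> y \<Longrightarrow> inverse (Suc n) \<le> dist x y" and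
      net: "\<And>x. \<exists>y\<in>S. dist x y < inverse (Suc n)"
      using max_separated_set[of "inverse (Suc n)"]
      by (metis inverse_positive_iff_positive of_nat_0_less_iff zero_less_Suc)
    define B where "B x = ball x (inverse (Suc n) / 2)" for x :: 'x
    have disj: "B x \<inter> B y = {}" if "x \<in> S" "y \<in> S" "x \<noteq> y" for x y
    proof (rule ccontr)
      assume "B x \<inter> B y \<noteq> {}"
      then obtain z where "dist x z < inverse (Suc n) / 2" "dist y z < inverse (Suc n) / 2"
        by (auto simp: B_def)
      with dist_triangle2[of x y z] sep[OF that] show False by linarith
    qed
    have B: "x \<in> B x" "open (B x)" for x
      by (auto simp: B_def)
    have "countable (B ` S)"
    proof (rule ccc)
      show "open G \<and> G \<noteq> {}" if "G \<in> B ` S" for G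
        using that B by blast
      show "disjoint (B ` S)"
        unfolding disjoint_def using disj by blast
    qed
    \<comment> \<open>The chain condition counts balls; injectivity carries the count over to their
      centres.\<close>
    moreover have "inj_on B S"
    proof (rule inj_onI)
      show "x = y" if "x \<in> S" "y \<in> S" "B x = B y" for x y
        using disj[of x y] B(1)[of x] that by auto
    qed
    ultimately have "countable S"
      by (rule countable_image_inj_on)
    with net show ?thesis by blast
  qed
  then show ?thesis
    using countable_dense_from_nets[of "UNIV :: 'x set"] by auto
qed

text \<open>A replacement for a countable base: balls of radius \<open>inverse (Suc n)\<close>
  around points of a countable \<open>D\<close> suffice at every point of \<open>closure D\<close>,
  even when \<open>D\<close> is dense only in part of the space.\<close>

lemma dense_ball_within_open:
  assumes "x \<in> closure D" "open U" "x \<in> U"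
  obtains d n where "d \<in> D" "x \<in> ball d (inverse (Suc n))" "ball d (inverse (Suc n)) \<subseteq> U"
proof -
  obtain e where e: "e > 0" "ball x e \<subseteq> U"
    using assms openE by blast
  then obtain n where n: "inverse (Suc n) < e / 2"
    using reals_Archimedean[of "e / 2"] by auto
  obtain d where d: "d \<in> D" "dist d x < inverse (Suc n)"
    using assms(1) unfolding closure_approachable by (metis inverse_positive_iff_positive of_nat_0_less_iff zero_less_Suc)
  have "ball d (inverse (Suc n)) \<subseteq> ball x e"
  proof
    fix y assume "y \<in> ball d (inverse (Suc n))"
    then show "y \<in> ball x e"
      using dist_triangle[of x y d] d n by (auto simp: dist_commute)
  qed
  then show thesis
    using that[of d n] d e by auto
qed

text \<open>In nonseparable spaces the Borel sets of a product can exceed the product sigma-algebra,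
  so measurability of the components does not settle the claim. With countable dense sets for the
  states and for the range of \<open>s\<close>, the preimage of an open set is a countable union of
  preimages of rectangles.\<close>

lemma borel_measurable_graph_map:
  fixes s :: "'x::metric_space \<Rightarrow> 'a::metric_space"
  assumes D: "countable (D :: 'x set)" "closure D = UNIV"
    and E: "countable E" "range s \<subseteq> closure E"
    and s: "s \<in> borel_measurable borel"
  shows "(\<lambda>x. (x, s x)) \<in> borel \<rightarrow>\<^sub>M borel"
proof (rule borel_measurableI)
  fix U :: "('x \<times> 'a) set" assume U: "open U"
  define B where "B p = ball (fst p) (inverse (Suc (snd p)))" for p :: "'x \<times> nat"
  define C where "C p = ball (fst p) (inverse (Suc (snd p)))" for p :: "'a \<times> nat"
  define I where "I = {(p, q) \<in> (D \<times> UNIV) \<times> (E \<times> UNIV). B p \<times> C q \<subseteq> U}"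
  have "countable I"
    unfolding I_def using D E by (intro countable_subset[OF _ countable_SIGMA, of _ "D \<times> UNIV" "\<lambda>_. E \<times> UNIV"]) auto
  moreover have "B p \<inter> (s -` C q) \<in> sets borel" for p q
    using measurable_sets[OF s, of "C q"] by (auto simp: B_def C_def)
  ultimately have "(\<Union>(p, q)\<in>I. B p \<inter> (s -` C q)) \<in> sets borel"
    by (auto intro!: sets.countable_UN')
  moreover have "(\<lambda>x. (x, s x)) -` U = (\<Union>(p, q)\<in>I. B p \<inter> (s -` C q))"
  proof (intro equalityI subsetI)
    fix x assume "x \<in> (\<lambda>x. (x, s x)) -` U"
    then obtain V W where VW: "open V" "open W" "x \<in> V" "s x \<in> W" "V \<times> W \<subseteq> U"
      using open_prod_elim[OF U, of "(x, s x)"] by (metis mem_Sigma_iff vimageE)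
    have "x \<in> closure D" "s x \<in> closure E" using D E by auto
    then obtain d n e m where "d \<in> D" "x \<in> ball d (inverse (Suc n))" "ball d (inverse (Suc n)) \<subseteq> V"
      "e \<in> E" "s x \<in> ball e (inverse (Suc m))" "ball e (inverse (Suc m)) \<subseteq> W"
      using VW dense_ball_within_open by metis
    then have "((d, n), (e, m)) \<in> I" "x \<in> B (d, n) \<inter> (s -` C (e, m))"
      using VW(5) by (auto simp: I_def B_def C_def)
    then show "x \<in> (\<Union>(p, q)\<in>I. B p \<inter> (s -` C q))" by blast
  qed (auto simp: I_def)
  ultimately show "(\<lambda>x. (x, s x)) -` U \<inter> space borel \<in> sets borel" by simp
qed

text \<open>At a fixed scale, a finite net of \<open>\<Gamma> x\<close> still covers
  \<open>\<Gamma> y\<close> for all \<open>y\<close> near \<open>x\<close>. Separability of the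
  state space reduces these neighbourhoods to countably many.\<close>

lemma upper_hemicontinuous_countable_dense:
  fixes \<Gamma> :: "'x::metric_space \<Rightarrow> 'a::metric_space set"
  assumes uhc: "upper_hemicontinuous \<Gamma>" and comp: "\<And>x. compact (\<Gamma> x)"
    and D: "countable (D :: 'x set)" "closure D = UNIV"
  shows "\<exists>E. countable E \<and> (\<Union>x. \<Gamma> x) \<subseteq> closure E"
proof -
  have "\<exists>E. countable E \<and> (\<forall>a\<in>\<Union>x. \<Gamma> x. \<exists>b\<in>E. dist a b < inverse (Suc n))" for n
  proof -
    have "\<exists>F. finite F \<and> \<Gamma> x \<subseteq> (\<Union>b\<in>F. ball b (inverse (Suc n)))" for x
      using seq_compact_imp_totally_bounded[OF compact_imp_seq_compact[OF comp[of x]],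
          rule_format, of "inverse (Suc n)"] by auto
    then obtain F where F: "\<And>x. finite (F x)" "\<And>x. \<Gamma> x \<subseteq> (\<Union>b\<in>F x. ball b (inverse (Suc n)))"
      by metis
    have "\<exists>U. open U \<and> x \<in> U \<and> (\<forall>y\<in>U. \<Gamma> y \<subseteq> (\<Union>b\<in>F x. ball b (inverse (Suc n))))" for x
      using uhc F(2)[of x] unfolding upper_hemicontinuous_def by (simp add: open_UN)
    then obtain U where U: "\<And>x. open (U x)" "\<And>x. x \<in> U x"
        "\<And>x y. y \<in> U x \<Longrightarrow> \<Gamma> y \<subseteq> (\<Union>b\<in>F x. ball b (inverse (Suc n)))"
      by metis
    define B where "B p = ball (fst p) (inverse (Suc (snd p)))" for p :: "'x \<times> nat"
    \<comment> \<open>Lindelof argument: each rational-type ball lying in some \<open>U x\<close>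
      selects one such \<open>x\<close> through \<open>c\<close> below, and these balls cover the
      space.\<close>
    define I where "I = {p \<in> D \<times> UNIV. \<exists>x. B p \<subseteq> U x}"
    have "\<forall>p\<in>I. \<exists>x. B p \<subseteq> U x"
      by (simp add: I_def)
    then obtain c where c: "\<And>p. p \<in> I \<Longrightarrow> B p \<subseteq> U (c p)"
      by (auto dest!: bchoice)
    have "countable I"
      unfolding I_def using D by (intro countable_subset[OF _ countable_SIGMA, of _ D "\<lambda>_. UNIV"]) auto
    then have "countable (\<Union>p\<in>I. F (c p))"
      using F(1) by (intro countable_UN) (auto intro: countable_finite)
    moreover have "\<exists>b\<in>\<Union>p\<in>I. F (c p). dist a b < inverse (Suc n)" if a: "a \<in> \<Gamma> x" for a x
    proof -
      obtain d m where dm: "d \<in> D" "x \<in> ball d (inverse (Suc m))" "ball d (inverse (Suc m)) \<subseteq> U x"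
        using dense_ball_within_open[of x D "U x"] D U by auto
      then have I: "(d, m) \<in> I" "x \<in> B (d, m)"
        by (auto simp: I_def B_def)
      then have "x \<in> U (c (d, m))" using c by blast
      then have "a \<in> (\<Union>b\<in>F (c (d, m)). ball b (inverse (Suc n)))"
        using U(3) a by blast
      with I show ?thesis
        by (auto simp: dist_commute)
    qed
    ultimately show ?thesis
      by (intro exI[of _ "\<Union>p\<in>I. F (c p)"]) auto
  qed
  then show ?thesis
    by (rule countable_dense_from_nets)
qed

lemma decreasing_compact_Inter_nonempty:
  fixes F :: "nat \<Rightarrow> 'a::metric_space set"
  assumes comp: "\<And>n. compact (F n)" and ne: "\<And>n. F n \<noteq> {}" and dec: "\<And>n. F (Suc n) \<subseteq> F n"
  shows "(\<Inter>n. F n) \<noteq> {}"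
proof -
  have mono: "F n \<subseteq> F m" if "m \<le> n" for m n
    using dec that by (rule lift_Suc_antimono_le)
  have "F 0 \<inter> (\<Inter>n\<in>UNIV. F n) \<noteq> {}"
  proof (rule compact_imp_fip_image[OF comp])
    show "closed (F n)" for n using comp by (rule compact_imp_closed)
    fix I :: "nat set" assume I: "finite I"
    show "F 0 \<inter> (\<Inter>n\<in>I. F n) \<noteq> {}"
    proof -
      have "F (Max (insert 0 I)) \<subseteq> F 0 \<inter> (\<Inter>n\<in>I. F n)"
        using I mono[of _ "Max (insert 0 I)"] by (simp add: INT_greatest)
      then show ?thesis using ne by blast
    qed
  qed
  then show ?thesis by blast
qed

text \<open>The selector minimises successively the distances to the points of a countable dense set;
  these distances determine a point, so the nested compact sets of minimisers shrink to a singleton.\<close>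

lemma compact_valued_measurable_selection:
  fixes F :: "'x \<Rightarrow> 'a::metric_space set"
  assumes comp: "\<And>x. x \<in> space M \<Longrightarrow> compact (F x)" and ne: "\<And>x. x \<in> space M \<Longrightarrow> F x \<noteq> {}"
    and E: "countable E" "(\<Union>x\<in>space M. F x) \<subseteq> closure E"
    and meas: "\<And>C. closed C \<Longrightarrow> {x \<in> space M. F x \<inter> C \<noteq> {}} \<in> sets M"
  obtains s where "s \<in> borel_measurable M" "\<And>x. x \<in> space M \<Longrightarrow> s x \<in> F x"
proof (cases "space M = {}")
  case True
  then have "(\<lambda>_. undefined) \<in> borel_measurable M"
    by simp
  then show thesis
    using that True by blast
next
  case False
  then have "E \<noteq> {}" using ne E(2) by auto
  define e where "e = from_nat_into E"
  have range_e: "range e = E"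
    unfolding e_def using \<open>E \<noteq> {}\<close> E(1) by (rule range_from_nat_into)
  \<comment> \<open>Stage \<open>Suc k\<close> keeps the points of stage \<open>k\<close> that are
    closest to \<open>e k\<close>.\<close>
  define G where "G = rec_nat F (\<lambda>k H x. {a \<in> H x. \<forall>b\<in>H x. dist a (e k) \<le> dist b (e k)})"
  have G_0: "G 0 = F" and G_Suc: "G (Suc k) x = {a \<in> G k x. \<forall>b\<in>G k x. dist a (e k) \<le> dist b (e k)}" for k x
    unfolding G_def by simp_all
  have cont: "continuous_on A (\<lambda>a. dist a (e k))" for A k
    by (intro continuous_intros)
  have G: "compact (G k x) \<and> G k x \<noteq> {}" if x: "x \<in> space M" for k x
  proof (induction k)
    case 0
    show ?case using comp ne x by (simp add: G_0)
  next
    case (Suc k)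
    obtain a where a: "a \<in> G k x" "\<And>b. b \<in> G k x \<Longrightarrow> dist a (e k) \<le> dist b (e k)"
      using continuous_attains_inf[OF _ _ cont, of "G k x" k] Suc by blast
    have "G (Suc k) x = G k x \<inter> {b. dist b (e k) \<le> dist a (e k)}"
      using a by (force simp: G_Suc)
    moreover have "closed {b. dist b (e k) \<le> dist a (e k)}"
      by (intro closed_Collect_le continuous_intros)
    ultimately have "compact (G (Suc k) x)"
      using Suc by (simp add: compact_Int_closed)
    moreover have "a \<in> G (Suc k) x" using a by (simp add: G_Suc)
    ultimately show ?case by blast
  qed
  have dec: "G (Suc k) x \<subseteq> G k x" for k x
    by (auto simp: G_Suc)
  have G_meas: "{x \<in> space M. G k x \<inter> C \<noteq> {}} \<in> sets M" if "closed C" for k C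
    using that
  proof (induction k arbitrary: C)
    case 0
    then show ?case using meas by (simp add: G_0)
  next
    case (Suc k)
    define L where "L q = {b. dist b (e k) \<le> real_of_rat q}" for q
    have L: "closed (L q)" for q
      unfolding L_def by (intro closed_Collect_le continuous_intros)
    \<comment> \<open>Hitting \<open>C\<close> at the next stage is expressed by countably many
      hitting conditions at stage \<open>k\<close>: if the least distance to \<open>e k\<close> over
      \<open>G k x \<inter> C\<close> exceeded that over \<open>G k x\<close>, a rational
      \<open>q\<close> strictly between them would violate the condition for
      \<open>L q\<close>.\<close>
    have "G (Suc k) x \<inter> C \<noteq> {} \<longleftrightarrow>
        G k x \<inter> C \<noteq> {} \<and> (\<forall>q. G k x \<inter> L q \<noteq> {} \<longrightarrow> G k x \<inter> (C \<inter> L q) \<noteq> {})"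
      if x: "x \<in> space M" for x
    proof (intro iffI conjI allI impI)
      assume *: "G k x \<inter> C \<noteq> {} \<and> (\<forall>q. G k x \<inter> L q \<noteq> {} \<longrightarrow> G k x \<inter> (C \<inter> L q) \<noteq> {})"
      have "compact (G k x \<inter> C)"
        using G[OF x] Suc.prems by (simp add: compact_Int_closed)
      then obtain a where a: "a \<in> G k x \<inter> C" "\<And>b. b \<in> G k x \<inter> C \<Longrightarrow> dist a (e k) \<le> dist b (e k)"
        using continuous_attains_inf[OF _ _ cont, of "G k x \<inter> C" k] * by blast
      have "dist a (e k) \<le> dist b (e k)" if b: "b \<in> G k x" for b
      proof (rule ccontr)
        assume "\<not> dist a (e k) \<le> dist b (e k)"
        then obtain q where q: "dist b (e k) < real_of_rat q" "real_of_rat q < dist a (e k)"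
          using of_rat_dense[of "dist b (e k)" "dist a (e k)"] by auto
        then have "b \<in> G k x \<inter> L q" using b by (simp add: L_def)
        then obtain c where "c \<in> G k x \<inter> C" "dist c (e k) \<le> real_of_rat q"
          using * by (auto simp: L_def)
        with a(2) q(2) show False by force
      qed
      then show "G (Suc k) x \<inter> C \<noteq> {}"
        using a(1) by (auto simp: G_Suc)
    qed (force simp: G_Suc L_def)+
    then have "{x \<in> space M. G (Suc k) x \<inter> C \<noteq> {}} = {x \<in> space M. G k x \<inter> C \<noteq> {} \<and>
        (\<forall>q. G k x \<inter> L q \<noteq> {} \<longrightarrow> G k x \<inter> (C \<inter> L q) \<noteq> {})}"
      by blast
    also have "\<dots> \<in> sets M"
      using Suc.IH[OF Suc.prems] Suc.IH[OF L] Suc.IH[OF closed_Int[OF Suc.prems L]]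
      by (intro sets.sets_Collect_conj sets.sets_Collect_countable_All sets.sets_Collect_imp)
    finally show ?case .
  qed
  have "\<exists>a. a \<in> (\<Inter>k. G k x)" if x: "x \<in> space M" for x
    using decreasing_compact_Inter_nonempty[of "\<lambda>k. G k x"] G[OF x] dec by blast
  then obtain s where s: "\<And>x k. x \<in> space M \<Longrightarrow> s x \<in> G k x"
    by (metis INT_D UNIV_I)
  \<comment> \<open>Two points surviving all stages have equal distances to every
    \<open>e k\<close>, yet some \<open>e k\<close> is closer to one of them than half their mutual
    distance.\<close>
  have unique: "a = s x" if x: "x \<in> space M" and a: "\<And>k. a \<in> G k x" for x a
  proof (rule ccontr)
    assume "a \<noteq> s x"
    have "a \<in> closure E"
      using a[of 0] x E(2) by (auto simp: G_0)
    then obtain k where k: "dist (e k) a < dist a (s x) / 2"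
      using \<open>a \<noteq> s x\<close> unfolding closure_approachable range_e[symmetric]
      by (metis half_gt_zero rangeE zero_less_dist_iff)
    have "dist (s x) (e k) = dist a (e k)"
      using s[OF x, of "Suc k"] a[of "Suc k"] by (auto simp: G_Suc intro: antisym)
    with k dist_triangle2[of a "s x" "e k"] show False
      by (simp add: dist_commute)
  qed
  have "s \<in> borel_measurable M"
  proof (rule borel_measurableI)
    fix U :: "'a set" assume U: "open U"
    \<comment> \<open>If every stage meets the closed set \<open>- U\<close>, compactness yields a
      common point of all stages there, and by \<open>unique\<close> this point is
      \<open>s x\<close>.\<close>
    have "s x \<in> - U \<longleftrightarrow> (\<forall>k. G k x \<inter> - U \<noteq> {})" if x: "x \<in> space M" for x
    proof
      assume *: "\<forall>k. G k x \<inter> - U \<noteq> {}"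
      have "(\<Inter>k. G k x \<inter> - U) \<noteq> {}"
        using * G[OF x] dec[of _ x] U
        by (intro decreasing_compact_Inter_nonempty compact_Int_closed) auto
      then show "s x \<in> - U"
        using unique[OF x] by auto
    qed (use s[OF x] in blast)
    then have "s -` U \<inter> space M = space M - (\<Inter>k. {x \<in> space M. G k x \<inter> - U \<noteq> {}})"
      by blast
    also have "\<dots> \<in> sets M"
      using G_meas[of "- U"] U by (intro sets.Diff sets.countable_INT) auto
    finally show "s -` U \<inter> space M \<in> sets M" .
  qed
  then show thesis
    using that s[of _ 0] by (auto simp: G_0)
qed

text \<open>From the fixed start \<open>x\<close>, the \<open>n\<close>-step probabilities of
  disjoint sets add up to at most 1, so at most \<open>Suc m\<close> of them exceed
  \<open>inverse (Suc m)\<close>. Irreducibility puts every member of a disjoint open family into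
  one of these countably many finite classes.\<close>

lemma weakly_irreducible_countable_dense:
  fixes K :: "'x::metric_space \<Rightarrow> 'x measure"
  assumes K: "markov_kernel K" and irr: "weakly_irreducible K"
  shows "\<exists>D :: 'x set. countable D \<and> closure D = UNIV"
proof (rule ccc_metric_countable_dense)
  fix F :: "'x set set" assume op: "\<And>G. G \<in> F \<Longrightarrow> open G \<and> G \<noteq> {}" and disj: "disjoint F"
  fix x :: 'x
  define F' where "F' n m = {G \<in> F. inverse (Suc m) < kernel_pow K n x G}" for n m
  have "finite (F' n m)" for n m
  proof (rule finite_if_finite_subsets_card_bdd[THEN conjunct1])
    show "card T \<le> Suc m" if T: "T \<subseteq> F' n m" "finite T" for T
    proof -
      have ind: "bounded_borel (indicator G)" if "G \<in> T" for G
        using that T(1) op by (intro bounded_borel_indicator) (auto simp: F'_def)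
      have "disjoint_family_on id T"
        using T(1) disj by (auto simp: disjoint_family_on_def disjoint_def F'_def)
      then have ind_Un: "indicat_real (\<Union>(id ` T)) y = (\<Sum>G\<in>T. indicator (id G) y)" for y :: 'x
        by (rule indicator_UN_disjoint[OF T(2)])
      then have "\<bar>\<Sum>G\<in>T. indicat_real G y\<bar> \<le> 1" for y
        by (simp add: indicator_def flip: ind_Un[simplified])
      then have "\<bar>(markov_op K ^^ n) (\<lambda>y. \<Sum>G\<in>T. indicator G y) x\<bar> \<le> 1"
        using bounded_borel_sum[OF ind] by (intro markov_op_power_abs_le K)
      moreover have "(markov_op K ^^ n) (\<lambda>y. \<Sum>G\<in>T. indicator G y) x = (\<Sum>G\<in>T. kernel_pow K n x G)"
        unfolding kernel_pow_def by (simp add: markov_op_power_sum[OF K T(2) ind])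
      moreover have "(\<Sum>G\<in>T. inverse (Suc m)) \<le> (\<Sum>G\<in>T. kernel_pow K n x G)"
        using T(1) by (intro sum_mono) (auto simp: F'_def less_imp_le)
      ultimately have "real (card T) * inverse (Suc m) \<le> 1"
        by simp
      then show ?thesis
        by (simp add: field_simps)
    qed
  qed
  then have "countable (\<Union>n m. F' n m)"
    by (intro countable_UN) (auto intro: countable_finite)
  moreover have "F \<subseteq> (\<Union>n m. F' n m)"
  proof
    fix G assume G: "G \<in> F"
    then obtain n where "kernel_pow K n x G > 0"
      using irr op[OF G] unfolding weakly_irreducible_def by (metis borel_open)
    then show "G \<in> (\<Union>n m. F' n m)"
      using G reals_Archimedean[of "kernel_pow K n x G"] by (auto simp: F'_def)
  qed
  ultimately show "countable F"
    by (rule countable_subset[rotated])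
qed

subsection \<open>The maximum theorem\<close>

text \<open>Upper hemicontinuity, applied to the open sets of points within \<open>e\<close> of
  \<open>\<Gamma> x\<close>, forces \<open>a n\<close> towards \<open>\<Gamma> x\<close>. Almost
  nearest points \<open>b n\<close> in the compact set \<open>\<Gamma> x\<close> have a convergent
  subsequence, and \<open>a\<close> follows it.\<close>

lemma upper_hemicontinuous_convergent_subseq:
  fixes \<Gamma> :: "'x::metric_space \<Rightarrow> 'a::metric_space set"
  assumes uhc: "upper_hemicontinuous \<Gamma>" and comp: "compact (\<Gamma> x)" and ne: "\<Gamma> x \<noteq> {}"
    and X: "X \<longlonglongrightarrow> x" and a: "\<And>n. a n \<in> \<Gamma> (X n)"
  obtains l f where "l \<in> \<Gamma> x" "strict_mono (f :: nat \<Rightarrow> nat)" "(\<lambda>n. a (f n)) \<longlonglongrightarrow> l"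
proof -
  have inf0: "(\<lambda>n. infdist (a n) (\<Gamma> x)) \<longlonglongrightarrow> 0"
  proof (rule order_tendstoI)
    fix e :: real assume "e < 0"
    then show "\<forall>\<^sub>F n in sequentially. e < infdist (a n) (\<Gamma> x)"
      using infdist_nonneg by (intro always_eventually allI) (rule less_le_trans)
  next
    fix e :: real assume e: "0 < e"
    have "open {b. infdist b (\<Gamma> x) < e}"
      by (intro open_Collect_less continuous_intros)
    moreover have "\<Gamma> x \<subseteq> {b. infdist b (\<Gamma> x) < e}"
      using e by auto
    ultimately obtain U where U: "open U" "x \<in> U" "\<And>y. y \<in> U \<Longrightarrow> \<Gamma> y \<subseteq> {b. infdist b (\<Gamma> x) < e}"
      using uhc unfolding upper_hemicontinuous_def by meson
    have "\<forall>\<^sub>F n in sequentially. X n \<in> U"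
      using X U(1,2) by (rule topological_tendstoD)
    then show "\<forall>\<^sub>F n in sequentially. infdist (a n) (\<Gamma> x) < e"
    proof (rule eventually_mono)
      show "infdist (a n) (\<Gamma> x) < e" if "X n \<in> U" for n
        using U(3)[OF that] a[of n] by blast
    qed
  qed
  have "\<exists>b\<in>\<Gamma> x. dist (a n) b < infdist (a n) (\<Gamma> x) + inverse (Suc n)" for n
  proof -
    have "(INF b\<in>\<Gamma> x. dist (a n) b) < infdist (a n) (\<Gamma> x) + inverse (Suc n)"
      using infdist_notempty[OF ne, of "a n"] by simp
    then show ?thesis
      using cInf_lessD[of "dist (a n) ` \<Gamma> x"] ne by auto
  qed
  then obtain b where b: "\<And>n. b n \<in> \<Gamma> x" "\<And>n. dist (a n) (b n) < infdist (a n) (\<Gamma> x) + inverse (Suc n)"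
    by metis
  obtain l f where l: "l \<in> \<Gamma> x" and f: "strict_mono (f :: nat \<Rightarrow> nat)" and lim: "(b \<circ> f) \<longlonglongrightarrow> l"
    using compact_imp_seq_compact[OF comp] b(1) by (auto elim!: seq_compactE)
  have "(\<lambda>n. infdist (a n) (\<Gamma> x) + inverse (Suc n)) \<longlonglongrightarrow> 0 + 0"
    by (intro tendsto_add inf0 LIMSEQ_inverse_real_of_nat)
  then have "(\<lambda>n. infdist (a (f n)) (\<Gamma> x) + inverse (Suc (f n))) \<longlonglongrightarrow> 0"
    using LIMSEQ_subseq_LIMSEQ[OF _ f, of "\<lambda>n. infdist (a n) (\<Gamma> x) + inverse (Suc n)" 0]
    by (simp add: comp_def)
  moreover have "(\<lambda>n. dist (b (f n)) l) \<longlonglongrightarrow> 0"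
    using tendsto_dist_iff[THEN iffD1, OF lim] by (simp add: comp_def)
  ultimately have "(\<lambda>n. (infdist (a (f n)) (\<Gamma> x) + inverse (Suc (f n))) + dist (b (f n)) l) \<longlonglongrightarrow> 0"
    by (rule tendsto_add_zero)
  then have "(\<lambda>n. dist (a (f n)) l) \<longlonglongrightarrow> 0"
  proof (rule Lim_null_comparison[rotated])
    show "\<forall>\<^sub>F n in sequentially. norm (dist (a (f n)) l)
        \<le> infdist (a (f n)) (\<Gamma> x) + inverse (Suc (f n)) + dist (b (f n)) l"
    proof (intro always_eventually allI)
      show "norm (dist (a (f n)) l) \<le> infdist (a (f n)) (\<Gamma> x) + inverse (Suc (f n)) + dist (b (f n)) l" for n
        using b(2)[of "f n"] dist_triangle[of "a (f n)" l "b (f n)"] by simp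
    qed
  qed
  then show thesis
    by (rule that[OF l f tendsto_dist_iff[THEN iffD2]])
qed

text \<open>Used twice: with constant \<open>g\<close> and \<open>C = UNIV\<close> it gives upper
  semicontinuity of a maximum, and with \<open>g\<close> the maximum itself it gives the
  measurability required for selecting maximisers.\<close>

lemma closed_superlevel_hit:
  fixes \<Gamma> :: "'x::metric_space \<Rightarrow> 'a::metric_space set" and g :: "'x \<Rightarrow> real"
  assumes uhc: "upper_hemicontinuous \<Gamma>" and comp: "\<And>x. compact (\<Gamma> x)" and ne: "\<And>x. \<Gamma> x \<noteq> {}"
    and q: "continuous_on (graph_corr \<Gamma>) q" and g: "continuous_on UNIV g" and C: "closed C"
  shows "closed {x. \<exists>a\<in>\<Gamma> x \<inter> C. g x \<le> q (x, a)}"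
  unfolding closed_sequential_limits
proof (intro allI impI, elim conjE)
  fix X x assume mem: "\<forall>n. X n \<in> {x. \<exists>a\<in>\<Gamma> x \<inter> C. g x \<le> q (x, a)}" and X: "X \<longlonglongrightarrow> x"
  then obtain a where a: "\<And>n. a n \<in> \<Gamma> (X n)" "\<And>n. a n \<in> C" "\<And>n. g (X n) \<le> q (X n, a n)"
    by simp (metis Int_iff)
  obtain l f where l: "l \<in> \<Gamma> x" and f: "strict_mono (f :: nat \<Rightarrow> nat)" and lim: "(\<lambda>n. a (f n)) \<longlonglongrightarrow> l"
    using upper_hemicontinuous_convergent_subseq[OF uhc comp ne X a(1)] by blast
  have X': "(\<lambda>n. X (f n)) \<longlonglongrightarrow> x"
    using LIMSEQ_subseq_LIMSEQ[OF X f] by (simp add: comp_def)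
  have "l \<in> C"
    using closed_sequentially[OF C _ lim] a(2) by blast
  moreover have "g x \<le> q (x, l)"
  proof (rule LIMSEQ_le)
    show "(\<lambda>n. g (X (f n))) \<longlonglongrightarrow> g x"
      by (rule continuous_on_tendsto_compose[OF g X']) auto
    show "(\<lambda>n. q (X (f n), a (f n))) \<longlonglongrightarrow> q (x, l)"
      by (rule continuous_on_tendsto_compose[OF q tendsto_Pair[OF X' lim]])
        (use l a(1) in \<open>auto simp: graph_corr_def\<close>)
  qed (use a(3) in auto)
  ultimately show "x \<in> {x. \<exists>a\<in>\<Gamma> x \<inter> C. g x \<le> q (x, a)}"
    using l by blast
qed

text \<open>Berge's theorem for an attained maximum \<open>w\<close>: lower hemicontinuity keeps
  actions close to a maximiser available at nearby states and so bounds \<open>w\<close> from below,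
  and upper hemicontinuity with compactness makes the superlevel sets of \<open>w\<close>
  closed.\<close>

lemma maximum_theorem:
  fixes \<Gamma> :: "'x::metric_space \<Rightarrow> 'a::metric_space set" and w :: "'x \<Rightarrow> real"
  assumes cc: "continuous_correspondence \<Gamma>" and comp: "\<And>x. compact (\<Gamma> x)" and ne: "\<And>x. \<Gamma> x \<noteq> {}"
    and q: "continuous_on (graph_corr \<Gamma>) q"
    and ub: "\<And>x a. a \<in> \<Gamma> x \<Longrightarrow> q (x, a) \<le> w x" and att: "\<And>x. \<exists>a\<in>\<Gamma> x. q (x, a) = w x"
  shows "continuous_on UNIV w"
proof -
  have uhc: "upper_hemicontinuous \<Gamma>" and lhc: "lower_hemicontinuous \<Gamma>"
    using cc by (auto simp: continuous_correspondence_def)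
  have "(w \<longlongrightarrow> w x) (at x)" for x
  proof (rule order_tendstoI)
    fix c assume c: "c < w x"
    obtain a where a: "a \<in> \<Gamma> x" "q (x, a) = w x" using att by blast
    then have "(x, a) \<in> graph_corr \<Gamma>" "q (x, a) \<in> {c<..}"
      using c by (auto simp: graph_corr_def)
    then obtain S where S: "open S" "(x, a) \<in> S" "\<And>p. p \<in> graph_corr \<Gamma> \<Longrightarrow> p \<in> S \<Longrightarrow> q p \<in> {c<..}"
      using q unfolding continuous_on_topological by (metis open_greaterThan)
    obtain U W where UW: "open U" "open W" "x \<in> U" "a \<in> W" "U \<times> W \<subseteq> S"
      using open_prod_elim[OF S(1,2)] by (metis mem_Sigma_iff)
    have "\<Gamma> x \<inter> W \<noteq> {}" using a UW by blast
    then obtain U' where U': "open U'" "x \<in> U'" "\<And>y. y \<in> U' \<Longrightarrow> \<Gamma> y \<inter> W \<noteq> {}"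
      using lhc UW(2) unfolding lower_hemicontinuous_def by meson
    have "c < w y" if y: "y \<in> U \<inter> U'" for y
    proof -
      obtain b where b: "b \<in> \<Gamma> y" "b \<in> W" using U'(3)[of y] y by auto
      then have "c < q (y, b)"
        using S(3)[of "(y, b)"] UW(5) y by (auto simp: graph_corr_def)
      also have "\<dots> \<le> w y" using ub b by blast
      finally show ?thesis .
    qed
    then show "\<forall>\<^sub>F y in at x. c < w y"
      using UW U' by (intro eventually_at_topological[THEN iffD2] exI[of _ "U \<inter> U'"]) auto
  next
    fix c assume c: "w x < c"
    have "(\<exists>a\<in>\<Gamma> x \<inter> UNIV. c \<le> q (x, a)) \<longleftrightarrow> c \<le> w x" for x
      using ub[of _ x] att[of x] by (metis Int_UNIV_right order_trans)
    then have "closed {x. c \<le> w x}"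
      using closed_superlevel_hit[OF uhc comp ne q, of "\<lambda>_. c" UNIV] by simp
    then have "open (- {x. c \<le> w x})" by (rule open_Compl)
    then show "\<forall>\<^sub>F y in at x. w y < c"
      using c by (intro eventually_at_topological[THEN iffD2] exI[of _ "- {x. c \<le> w x}"]) auto
  qed
  then show ?thesis
    by (simp add: continuous_on_def)
qed

subsection \<open>The Bellman equation and optimal policies\<close>

lemma MDP_D:
  fixes v :: "'x::metric_space \<Rightarrow> real"
  assumes "MDP r \<Gamma> \<beta> P"
  shows "0 < \<beta>" "\<beta> < 1" "\<Gamma> x \<noteq> {}" "compact (\<Gamma> x)" "continuous_correspondence \<Gamma>"
    "upper_hemicontinuous \<Gamma>"
    "continuous_on (graph_corr \<Gamma>) (\<lambda>(x, a). r x a)"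
    "a \<in> \<Gamma> x \<Longrightarrow> prob_space (P x a)" "a \<in> \<Gamma> x \<Longrightarrow> sets (P x a) = sets borel"
    "continuous_on UNIV v \<Longrightarrow> bounded (range v) \<Longrightarrow>
        continuous_on (graph_corr \<Gamma>) (\<lambda>(x, a). \<integral>x'. v x' \<partial>(P x a))"
  using assms unfolding MDP_def continuous_correspondence_def graph_corr_def by auto

lemma MDP_reward_bound:
  assumes "MDP r \<Gamma> \<beta> P"
  obtains R where "\<And>x a. a \<in> \<Gamma> x \<Longrightarrow> \<bar>r x a\<bar> \<le> R"
proof -
  have "bounded ((\<lambda>(x, a). r x a) ` graph_corr \<Gamma>)"
    using assms unfolding MDP_def by blast
  then show thesis
    using that by (force simp: bounded_iff graph_corr_def)
qed

text \<open>The state-action value, or Q-function, with continuation value \<open>v\<close>.\<close>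

definition bellman_value ::
  "('x::metric_space \<Rightarrow> 'a \<Rightarrow> real) \<Rightarrow> real \<Rightarrow> ('x \<Rightarrow> 'a \<Rightarrow> 'x measure) \<Rightarrow> ('x \<Rightarrow> real) \<Rightarrow> 'x \<Rightarrow> 'a \<Rightarrow> real" where
  "bellman_value r \<beta> P v x a = r x a + \<beta> * (\<integral>x'. v x' \<partial>(P x a))"

lemma continuous_bellman_value:
  assumes "MDP r \<Gamma> \<beta> P" "continuous_on UNIV v" "bounded (range v)"
  shows "continuous_on (graph_corr \<Gamma>) (\<lambda>(x, a). bellman_value r \<beta> P v x a)"
  using continuous_on_add[OF MDP_D(7)[OF assms(1)] continuous_on_mult_left[OF MDP_D(10)[OF assms], of \<beta>]]
  by (simp add: bellman_value_def case_prod_unfold)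

text \<open>Integration against a probability measure does not increase the supremum distance. The
  estimate is one-sided, the form that passes to a maximum over actions; exchanging \<open>u\<close>
  and \<open>v\<close> gives the other side.\<close>

lemma bellman_value_lipschitz:
  assumes mdp: "MDP r \<Gamma> \<beta> P" and a: "a \<in> \<Gamma> x"
  shows "bellman_value r \<beta> P (apply_bcontfun u) x a
      \<le> bellman_value r \<beta> P (apply_bcontfun v) x a + \<beta> * dist u v"
proof -
  interpret prob_space "P x a" using MDP_D(8)[OF mdp a] .
  have int: "integrable (P x a) (apply_bcontfun v)" for v :: "'a \<Rightarrow>\<^sub>C real"
    using MDP_D(8,9)[OF mdp a] by (rule integrable_bounded_borel) (rule bounded_borel_continuous; simp)
  have "(\<integral>y. u y \<partial>P x a) \<le> (\<integral>y. v y + dist u v \<partial>P x a)"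
  proof (rule integral_mono)
    show "u y \<le> v y + dist u v" for y
      using dist_bounded[of u y v] by (simp add: dist_real_def)
  qed (auto intro: int)
  also have "\<dots> = (\<integral>y. v y \<partial>P x a) + dist u v"
    using int by (simp add: prob_space)
  finally show ?thesis
    using mult_left_mono[of _ _ \<beta>] MDP_D(1)[OF mdp]
    by (simp add: bellman_value_def distrib_left[symmetric])
qed

text \<open>Maximising over actions defines an operator \<open>T\<close> on bounded continuous
  functions by the maximum theorem. It contracts distances by \<open>\<beta>\<close>, and the space
  is complete, so Banach's theorem supplies \<open>V\<close>.\<close>

lemma bellman_equation:
  assumes mdp: "MDP r \<Gamma> \<beta> P"
  obtains V where "continuous_on UNIV V" "bounded (range V)"
    "\<And>x a. a \<in> \<Gamma> x \<Longrightarrow> bellman_value r \<beta> P V x a \<le> V x"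
    "\<And>x. \<exists>a\<in>\<Gamma> x. bellman_value r \<beta> P V x a = V x"
proof -
  note D = MDP_D[OF mdp]
  let ?q = "\<lambda>v. bellman_value r \<beta> P (apply_bcontfun v)"
  have "\<exists>w. (\<forall>x. (\<forall>a\<in>\<Gamma> x. ?q v x a \<le> apply_bcontfun w x) \<and> (\<exists>a\<in>\<Gamma> x. ?q v x a = apply_bcontfun w x))" for v
  proof -
    have q: "continuous_on (graph_corr \<Gamma>) (\<lambda>(x, a). ?q v x a)"
      by (rule continuous_bellman_value[OF mdp]) auto
    have "\<exists>a\<in>\<Gamma> x. \<forall>b\<in>\<Gamma> x. ?q v x b \<le> ?q v x a" for x
    proof (rule continuous_attains_sup)
      show "continuous_on (\<Gamma> x) (?q v x)"
        using continuous_on_compose2[OF q, of "\<Gamma> x" "Pair x"]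
        by (force simp: graph_corr_def intro: continuous_on_Pair continuous_on_const continuous_on_id)
    qed (use D in auto)
    then obtain m where m: "\<And>x. m x \<in> \<Gamma> x" "\<And>x b. b \<in> \<Gamma> x \<Longrightarrow> ?q v x b \<le> ?q v x (m x)"
      by metis
    define w where "w x = ?q v x (m x)" for x
    have "continuous_on UNIV w"
      by (rule maximum_theorem[OF D(5,4,3) q]) (use m in \<open>auto simp: w_def\<close>)
    moreover have "bounded (range w)"
    proof -
      obtain R where R: "\<And>x a. a \<in> \<Gamma> x \<Longrightarrow> \<bar>r x a\<bar> \<le> R"
        using MDP_reward_bound[OF mdp] by blast
      \<comment> \<open>Comparison with continuation value 0, for which the Bellman value is just
        the reward.\<close>
      have "\<bar>w x\<bar> \<le> R + \<beta> * dist v 0" for x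
        using bellman_value_lipschitz[OF mdp m(1)[of x], of v 0] R[OF m(1)[of x]]
          bellman_value_lipschitz[OF mdp m(1)[of x], of 0 v]
        by (auto simp: w_def bellman_value_def dist_commute)
      then show ?thesis by (auto simp: bounded_iff)
    qed
    ultimately have "w \<in> bcontfun" by (simp add: bcontfun_def)
    then obtain w' where "w = apply_bcontfun w'" by (rule bcontfunE)
    then show ?thesis
      using m by (intro exI[of _ w']) (auto simp: w_def[abs_def] fun_eq_iff dest: sym)
  qed
  then obtain T where T: "\<And>v x a. a \<in> \<Gamma> x \<Longrightarrow> ?q v x a \<le> apply_bcontfun (T v) x"
      "\<And>v x. \<exists>a\<in>\<Gamma> x. ?q v x a = apply_bcontfun (T v) x"
    by metis
  \<comment> \<open>A maximising action for \<open>u\<close> is also a candidate for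
    \<open>v\<close>.\<close>
  have le: "apply_bcontfun (T u) x \<le> apply_bcontfun (T v) x + \<beta> * dist u v" for u v x
  proof -
    obtain a where "a \<in> \<Gamma> x" "?q u x a = apply_bcontfun (T u) x" using T(2) by blast
    then show ?thesis
      using bellman_value_lipschitz[OF mdp, of a x u v] T(1)[of a x v] by linarith
  qed
  have "\<exists>!V. T V = V"
  proof (rule banach_fix_type)
    show "\<forall>u v. dist (T u) (T v) \<le> \<beta> * dist u v"
    proof (intro allI dist_bound)
      show "dist (apply_bcontfun (T u) x) (apply_bcontfun (T v) x) \<le> \<beta> * dist u v" for u v x
        using le[of u x v] le[of v x u] by (simp add: dist_real_def dist_commute abs_le_iff)
    qed
  qed (use D(1,2) in auto)
  then obtain V where V: "T V = V" by blast
  show thesis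
    by (rule that[of "apply_bcontfun V"]) (use T[where v=V] V in auto)
qed

text \<open>Both objects arise by composing a function continuous on the graph of
  \<open>\<Gamma>\<close> with \<open>\<lambda>x. (x, s x)\<close>, which is Borel because
  \<open>s\<close> takes values in a separable set.\<close>

lemma policy_kernel_reward_measurable:
  fixes P :: "'x::metric_space \<Rightarrow> 'a::metric_space \<Rightarrow> 'x measure"
  assumes mdp: "MDP r \<Gamma> \<beta> P" and D: "countable (D :: 'x set)" "closure D = UNIV"
    and s: "s \<in> policies \<Gamma>"
  shows "markov_kernel (policy_kernel P s)" "bounded_borel (policy_reward r s)"
proof -
  have s: "s \<in> borel_measurable borel" "\<And>x. s x \<in> \<Gamma> x"
    using s by (auto simp: policies_def)
  obtain E where E: "countable E" "(\<Union>x. \<Gamma> x) \<subseteq> closure E"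
    using upper_hemicontinuous_countable_dense[OF MDP_D(6,4)[OF mdp] D] by blast
  then have "range s \<subseteq> closure E" using s(2) by blast
  note graph = borel_measurable_graph_map[OF D E(1) this s(1)]
  have meas: "(\<lambda>x. q x (s x)) \<in> borel_measurable borel"
    if "continuous_on (graph_corr \<Gamma>) (\<lambda>(x, a). q x a)" for q :: "'x \<Rightarrow> 'a \<Rightarrow> real"
  proof -
    have "(\<lambda>x. (x, s x)) \<in> borel \<rightarrow>\<^sub>M restrict_space borel (graph_corr \<Gamma>)"
      using graph s(2) by (intro measurable_restrict_space2) (auto simp: graph_corr_def)
    from measurable_compose[OF this borel_measurable_continuous_on_restrict[OF that]]
    show ?thesis by simp
  qed
  show "markov_kernel (policy_kernel P s)"
    using s(2) MDP_D(8,9)[OF mdp] meas[OF MDP_D(10)[OF mdp]]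
    by (intro markov_kernelI) (auto simp: policy_kernel_def)
  obtain R where "\<And>x a. a \<in> \<Gamma> x \<Longrightarrow> \<bar>r x a\<bar> \<le> R"
    using MDP_reward_bound[OF mdp] by blast
  then show "bounded_borel (policy_reward r s)"
    using meas[OF MDP_D(7)[OF mdp]] s(2) unfolding policy_reward_def
    by (intro bounded_borelI) auto
qed

text \<open>A measurable selection of maximisers turns the Bellman equation into the linear equation
  of a stationary policy, whose bounded solution is the value of that policy. For any other policy
  only the inequality holds, and it bounds the value of that policy by \<open>V\<close>.\<close>

lemma optimal_policy_exists:
  fixes P :: "'x::metric_space \<Rightarrow> 'a::metric_space \<Rightarrow> 'x measure"
  assumes mdp: "MDP r \<Gamma> \<beta> P" and D: "countable (D :: 'x set)" "closure D = UNIV"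
  obtains V s where "continuous_on UNIV V" "bounded (range V)" "s \<in> policies \<Gamma>"
    "\<And>x. policy_value r \<beta> P s x = V x"
    "\<And>x. policy_reward r s x + \<beta> * markov_op (policy_kernel P s) V x = V x"
    "\<And>u x. u \<in> policies \<Gamma> \<Longrightarrow> policy_reward r u x + \<beta> * markov_op (policy_kernel P u) V x \<le> V x"
    "\<And>u x. u \<in> policies \<Gamma> \<Longrightarrow> policy_value r \<beta> P u x \<le> V x"
proof -
  obtain V where V: "continuous_on UNIV V" "bounded (range V)"
      "\<And>x a. a \<in> \<Gamma> x \<Longrightarrow> bellman_value r \<beta> P V x a \<le> V x"
      "\<And>x. \<exists>a\<in>\<Gamma> x. bellman_value r \<beta> P V x a = V x"
    using bellman_equation[OF mdp] by blast
  have Vb: "bounded_borel V" using V(1,2) by (rule bounded_borel_continuous)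
  obtain E where E: "countable E" "(\<Union>x. \<Gamma> x) \<subseteq> closure E"
    using upper_hemicontinuous_countable_dense[OF MDP_D(6,4)[OF mdp] D] by blast
  \<comment> \<open>Since \<open>V x\<close> is an upper bound for the Bellman value, these are
    exactly the maximisers; the inequality matches the form of
    \<open>closed_superlevel_hit\<close>.\<close>
  define F where "F x = {a \<in> \<Gamma> x. V x \<le> bellman_value r \<beta> P V x a}" for x
  note q = continuous_bellman_value[OF mdp V(1,2)]
  have F_compact: "compact (F x)" for x
  proof -
    have "continuous_on (\<Gamma> x) (bellman_value r \<beta> P V x)"
      using continuous_on_compose2[OF q, of "\<Gamma> x" "Pair x"]
      by (force simp: graph_corr_def intro: continuous_on_Pair continuous_on_const continuous_on_id)
    then have "closedin (top_of_set (\<Gamma> x)) (\<Gamma> x \<inter> bellman_value r \<beta> P V x -` {V x..})"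
      by (rule continuous_closedin_preimage) simp
    moreover have "\<Gamma> x \<inter> bellman_value r \<beta> P V x -` {V x..} = F x"
      by (auto simp: F_def)
    ultimately show ?thesis
      using MDP_D(4)[OF mdp] closedin_compact by metis
  qed
  have F_ne: "F x \<noteq> {}" for x
    using V(4)[of x] by (force simp: F_def)
  have F_dense: "(\<Union>x\<in>space borel. F x) \<subseteq> closure E"
    using E(2) by (auto simp: F_def)
  have F_meas: "{x \<in> space borel. F x \<inter> C \<noteq> {}} \<in> sets borel" if "closed C" for C
  proof -
    have "{x. \<exists>a\<in>\<Gamma> x \<inter> C. V x \<le> (\<lambda>(x, a). bellman_value r \<beta> P V x a) (x, a)} = {x \<in> space borel. F x \<inter> C \<noteq> {}}"
      by (auto simp: F_def)
    with closed_superlevel_hit[OF MDP_D(6,4,3)[OF mdp] q V(1) that] show ?thesis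
      by (metis borel_closed)
  qed
  obtain s where s: "s \<in> borel_measurable borel" "\<And>x. s x \<in> F x"
    by (rule compact_valued_measurable_selection[OF F_compact F_ne E(1) F_dense F_meas]) auto
  have pol: "s \<in> policies \<Gamma>"
    using s by (auto simp: policies_def F_def)
  have bell: "policy_reward r u x + \<beta> * markov_op (policy_kernel P u) V x = bellman_value r \<beta> P V x (u x)" for u x
    by (simp add: policy_reward_def markov_op_def policy_kernel_def bellman_value_def)
  have eq: "policy_reward r s x + \<beta> * markov_op (policy_kernel P s) V x = V x" for x
    using s(2)[of x] V(3)[of "s x" x] unfolding bell by (auto simp: F_def)
  have le: "policy_reward r u x + \<beta> * markov_op (policy_kernel P u) V x \<le> V x" if "u \<in> policies \<Gamma>" for u x
    using that V(3)[of "u x" x] unfolding bell by (auto simp: policies_def)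
  have b: "0 \<le> \<beta>" "\<beta> < 1" using MDP_D(1,2)[OF mdp] by auto
  show thesis
  proof (rule that[OF V(1,2) pol _ eq le])
    show "policy_value r \<beta> P s x = V x" for x
      unfolding policy_value_def
      by (rule discounted_sum_eqI[OF policy_kernel_reward_measurable[OF mdp D pol] Vb b eq])
    show "policy_value r \<beta> P u x \<le> V x" if u: "u \<in> policies \<Gamma>" for u x
      unfolding policy_value_def
      by (rule discounted_sum_le[OF policy_kernel_reward_measurable[OF mdp D u] Vb b le[OF u]])
  qed
qed

text \<open>Making \<open>\<sigma>\<close> the only feasible policy lets the existence result speak
  about the value of \<open>\<sigma>\<close> itself. Continuity of \<open>\<sigma>\<close> is what
  makes the singleton correspondence continuous.\<close>

lemma MDP_singleton:
  assumes mdp: "MDP r \<Gamma> \<beta> P" and pol: "\<sigma> \<in> policies \<Gamma>" and cont: "continuous_on UNIV \<sigma>"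
  shows "MDP r (\<lambda>x. {\<sigma> x}) \<beta> P" "policies (\<lambda>x. {\<sigma> x}) = {\<sigma>}"
proof -
  have s: "\<sigma> \<in> borel_measurable borel" "\<And>x. \<sigma> x \<in> \<Gamma> x"
    using pol by (auto simp: policies_def)
  then have sub: "graph_corr (\<lambda>x. {\<sigma> x}) \<subseteq> graph_corr \<Gamma>"
    by (auto simp: graph_corr_def)
  have "\<exists>U. open U \<and> x \<in> U \<and> (\<forall>y\<in>U. \<sigma> y \<in> V)" if "open V" "\<sigma> x \<in> V" for x V
    using open_vimage[OF that(1) cont] that(2) by (intro exI[of _ "\<sigma> -` V"]) auto
  then have "continuous_correspondence (\<lambda>x. {\<sigma> x})"
    by (simp add: continuous_correspondence_def upper_hemicontinuous_def lower_hemicontinuous_def)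
  moreover have "bounded ((\<lambda>(x, a). r x a) ` graph_corr \<Gamma>)"
    using mdp unfolding MDP_def by blast
  then have "bounded ((\<lambda>(x, a). r x a) ` graph_corr (\<lambda>x. {\<sigma> x}))"
    by (rule bounded_subset[OF _ image_mono[OF sub]])
  ultimately show "MDP r (\<lambda>x. {\<sigma> x}) \<beta> P"
    unfolding MDP_def
    using MDP_D(1,2)[OF mdp] continuous_on_subset[OF MDP_D(7)[OF mdp] sub] s(2)
      MDP_D(8,9)[OF mdp] continuous_on_subset[OF MDP_D(10)[OF mdp] sub]
    by (simp add: graph_corr_def)
  show "policies (\<lambda>x. {\<sigma> x}) = {\<sigma>}"
    using s by (auto simp: policies_def)
qed

section \<open>Optimality at one state, on average, and everywhere\<close>

theorem theorem4p4:
  fixes r :: "'x::metric_space \<Rightarrow> 'a::metric_space \<Rightarrow> real"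
    and \<Gamma> :: "'x \<Rightarrow> 'a set" and \<beta> :: real
    and P :: "'x \<Rightarrow> 'a \<Rightarrow> 'x measure" and \<sigma> :: "'x \<Rightarrow> 'a"
  assumes mdp: "MDP r \<Gamma> \<beta> P"
    and pol: "\<sigma> \<in> policies \<Gamma>"
    and irr: "weakly_irreducible (policy_kernel P \<sigma>)"
    and cont: "continuous_on UNIV \<sigma>"
  shows "((\<exists>x. \<forall>s\<in>policies \<Gamma>. policy_value r \<beta> P s x \<le> policy_value r \<beta> P \<sigma> x)
            \<longleftrightarrow> (\<exists>\<rho>::'x measure. prob_space \<rho> \<and> sets \<rho> = sets borel \<and>
                  (\<forall>s\<in>policies \<Gamma>. (\<integral>x. policy_value r \<beta> P s x \<partial>\<rho>) \<le> (\<integral>x. policy_value r \<beta> P \<sigma> x \<partial>\<rho>))))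
       \<and> ((\<exists>\<rho>::'x measure. prob_space \<rho> \<and> sets \<rho> = sets borel \<and>
                  (\<forall>s\<in>policies \<Gamma>. (\<integral>x. policy_value r \<beta> P s x \<partial>\<rho>) \<le> (\<integral>x. policy_value r \<beta> P \<sigma> x \<partial>\<rho>)))
            \<longleftrightarrow> (\<forall>x. policy_value r \<beta> P \<sigma> x = value_function r \<Gamma> \<beta> P x))"
    (is "(?E1 \<longleftrightarrow> ?E2) \<and> (?E2 \<longleftrightarrow> ?E3)")
proof -
  let ?v = "policy_value r \<beta> P"
  let ?K = "policy_kernel P \<sigma>"
  have b: "0 < \<beta>" using MDP_D(1)[OF mdp] .
  have \<sigma>: "\<sigma> x \<in> \<Gamma> x" for x
    using pol by (auto simp: policies_def)
  \<comment> \<open>Continuity of \<open>\<sigma>\<close> gives the kernel property directly. The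
    measurability lemma for general policies presupposes a countable dense set, which is obtained
    only afterwards from this kernel.\<close>
  have K: "markov_kernel ?K"
  proof (rule markov_kernelI)
    fix v :: "'x \<Rightarrow> real" assume "continuous_on UNIV v" "bounded (range v)"
    from MDP_D(10)[OF mdp this]
    have "continuous_on UNIV (\<lambda>x. (\<lambda>(x, a). \<integral>x'. v x' \<partial>P x a) (x, \<sigma> x))"
      by (rule continuous_on_compose2)
        (use \<sigma> cont in \<open>auto simp: graph_corr_def intro: continuous_on_Pair continuous_on_id\<close>)
    then show "(\<lambda>x. \<integral>y. v y \<partial>?K x) \<in> borel_measurable borel"
      by (intro borel_measurable_continuous_onI) (simp add: policy_kernel_def)
  qed (use \<sigma> MDP_D(8,9)[OF mdp] in \<open>auto simp: policy_kernel_def\<close>)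
  obtain D :: "'x set" where D: "countable D" "closure D = UNIV"
    using weakly_irreducible_countable_dense[OF K irr] by blast
  obtain V s where V: "continuous_on UNIV V" "bounded (range V)" and s: "s \<in> policies \<Gamma>"
    and vs: "\<And>x. ?v s x = V x"
    and sup: "\<And>u x. u \<in> policies \<Gamma> \<Longrightarrow> policy_reward r u x + \<beta> * markov_op (policy_kernel P u) V x \<le> V x"
    and le: "\<And>u x. u \<in> policies \<Gamma> \<Longrightarrow> ?v u x \<le> V x"
    using optimal_policy_exists[OF mdp D] by metis
  note sing = MDP_singleton[OF mdp pol cont]
  \<comment> \<open>In the singleton model the optimal policy can only be \<open>\<sigma>\<close>,
    so its value is a bounded continuous function \<open>U\<close>.\<close>
  obtain U where U: "continuous_on UNIV U" "bounded (range U)"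
    and v\<sigma>: "\<And>x. ?v \<sigma> x = U x"
    and eq: "\<And>x. policy_reward r \<sigma> x + \<beta> * markov_op ?K U x = U x"
    using optimal_policy_exists[OF sing(1) D] unfolding sing(2) by (metis singletonD)
  have UV: "U x \<le> V x" for x
    using le[OF pol, of x] v\<sigma> by simp
  have bb: "bounded_borel U" "bounded_borel V"
    using U V by (auto intro: bounded_borel_continuous)
  have zero: "U y = V y" if x: "U x = V x" for x y
  proof -
    have bbh: "bounded_borel (\<lambda>x. V x + - 1 * U x)"
      using bb by (intro bounded_borel_add bounded_borel_cmult)
    have "V y + - 1 * U y = 0"
    proof (rule superharmonic_zero[OF K irr, where x=x])
      show "continuous_on UNIV (\<lambda>x. V x + - 1 * U x)"
        using U V by (intro continuous_intros)
      show "bounded (range (\<lambda>x. V x + - 1 * U x))"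
        using bbh by (simp add: bounded_borel_def)
      \<comment> \<open>Subtracting the equation for \<open>U\<close> from the Bellman inequality
        for \<open>V\<close> under \<open>\<sigma>\<close> cancels the rewards.\<close>
      show "\<beta> * markov_op ?K (\<lambda>x. V x + - 1 * U x) y \<le> V y + - 1 * U y" for y
        using sup[OF pol, of y] eq[of y]
        unfolding markov_op_add[OF K bb(2) bounded_borel_cmult[OF bb(1)]] markov_op_cmult
        by (simp add: algebra_simps)
    qed (use UV x b in auto)
    then show ?thesis by simp
  qed
  have vf: "value_function r \<Gamma> \<beta> P x = V x" for x
    unfolding value_function_def
  proof (rule cSup_eq_maximum)
    show "V x \<in> (\<lambda>s. ?v s x) ` policies \<Gamma>" by (intro image_eqI[of _ _ s]) (simp_all add: vs s)
  qed (use le in auto)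
  \<comment> \<open>The witness is the point mass at \<open>x\<close>.\<close>
  have E12: ?E2 if E1: ?E1
  proof -
    obtain x where x: "\<And>u. u \<in> policies \<Gamma> \<Longrightarrow> ?v u x \<le> ?v \<sigma> x" using E1 by blast
    have "(\<integral>y. ?v u y \<partial>return borel x) = ?v u x" if "u \<in> policies \<Gamma>" for u
    proof (rule integral_return)
      show "?v u \<in> borel_measurable borel"
        unfolding policy_value_def[abs_def]
        by (rule measurable_discounted_sum[OF policy_kernel_reward_measurable[OF mdp D that]])
    qed simp
    then show ?thesis
      using x pol by (intro exI[of _ "return borel x"]) (auto simp: prob_space_return)
  qed
  have E23: ?E3 if E2: ?E2
  proof -
    obtain \<rho> :: "'x measure" where \<rho>: "prob_space \<rho>" "sets \<rho> = sets borel"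
      and int: "\<And>u. u \<in> policies \<Gamma> \<Longrightarrow> (\<integral>x. ?v u x \<partial>\<rho>) \<le> (\<integral>x. ?v \<sigma> x \<partial>\<rho>)"
      using E2 by blast
    interpret prob_space \<rho> by fact
    note integ = bb[THEN integrable_bounded_borel[OF \<rho>]]
    \<comment> \<open>Comparing with the optimal policy \<open>s\<close> alone suffices: the
      nonnegative gap then has integral 0, so it vanishes almost everywhere, hence at some state
      because \<open>\<rho>\<close> is a probability measure, and \<open>zero\<close> spreads this
      to all states.\<close>
    have "(\<integral>x. V x \<partial>\<rho>) \<le> (\<integral>x. U x \<partial>\<rho>)"
      using int[OF s] by (simp add: vs v\<sigma>)
    then have "(\<integral>x. V x - U x \<partial>\<rho>) \<le> 0"
      using integ by simp
    moreover have "0 \<le> (\<integral>x. V x - U x \<partial>\<rho>)"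
      using UV by (intro integral_nonneg_AE) auto
    ultimately have "AE x in \<rho>. V x - U x = 0"
      using integral_nonneg_eq_0_iff_AE[of \<rho> "\<lambda>x. V x - U x"] integ UV by simp
    then obtain x where "V x - U x = 0"
      using eventually_happens'[OF ae_filter_bot] by blast
    then show ?thesis
      using zero[of x] by (simp add: v\<sigma> vf)
  qed
  have E31: ?E1 if ?E3
    using that le by (auto simp: vf)
  show ?thesis
    using E12 E23 E31 by blast
qed

end
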